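(* There is no upper bound, depending only on the tracial floor $M$ and the number $n$ of nonzero eigenvalues, for the smallest size of a primitive real matrix realizing an admissible nonzero spectrum; this fails already at $n=4$. That is, there is no function $f:[0,\infty)\to\mathbb N$ such that every admissible $4$-tuple $\Lambda$ is the nonzero spectrum of a primitive real matrix of size $N\times N$ for some $N\le f(M(\Lambda))$.
   Context: A primitive matrix is a square matrix with nonnegative real entries some positive power of which has all entries positive. If a square real matrix $A$ has characteristic polynomial $t^j\prod_{i=1}^k(t-\lambda_i)$ with all $\lambda_i\neq 0$, its nonzero spectrum is $(\lambda_1,\dots,\lambda_k)$, regarded as a multiset. For a tuple $\Lambda=(\lambda_1,\dots,\lambda_n)$ of nonzero complex numbers, put $\Lambda^k=(\lambda_1^k,\dots,\lambda_n^k)$ and $\operatorname{trace}(\Lambda^k)=\sum_i\lambda_i^k$. Call $\Lambda$ ($n\ge2$) admissible if: $\lambda_1=1$ and $|\lambda_i|<1$ for $2\le i\le n$; the polynomial $\prod_i(t-\lambda_i)$ has real coefficients; $\operatorname{trace}(\Lambda)\ge 0$; and $\operatorname{trace}(\Lambda^k)>0$ for all $k\ge 2$. The tracial floor is $M(\Lambda)=\inf\{\operatorname{trace}(\Lambda^k):k\ge 2\}$. (A theorem of Laffey shows every admissible $\Lambda$ is the nonzero spectrum of some primitive real matrix, with an explicit bound on its size.) *)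

theory Defs
  imports Complex_Main "Jordan_Normal_Form.Char_Poly"
begin

definition primitive_mat :: "real mat \<Rightarrow> bool" where
  "primitive_mat A \<longleftrightarrow>
     square_mat A \<and> 0 < dim_row A \<and>
     (\<forall>i<dim_row A. \<forall>j<dim_row A. 0 \<le> A $$ (i, j)) \<and>
     (\<exists>k>0. \<forall>i<dim_row A. \<forall>j<dim_row A. 0 < (A ^\<^sub>m k) $$ (i, j))"

definition root_poly :: "complex list \<Rightarrow> complex poly" where
  "root_poly \<Lambda> = (\<Prod>z\<leftarrow>\<Lambda>. [:- z, 1:])"

text \<open>The order of the list is irrelevant here: the list represents the multiset of nonzero
  eigenvalues, repeated according to algebraic multiplicity.\<close>

definition has_nonzero_spectrum :: "real mat \<Rightarrow> complex list \<Rightarrow> bool" where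
  "has_nonzero_spectrum A \<Lambda> \<longleftrightarrow>
     square_mat A \<and> 0 \<notin> set \<Lambda> \<and>
     (\<exists>j. map_poly complex_of_real (char_poly A) = monom 1 j * root_poly \<Lambda>)"

definition power_trace :: "complex list \<Rightarrow> nat \<Rightarrow> complex" where
  "power_trace \<Lambda> k = (\<Sum>z\<leftarrow>\<Lambda>. z ^ k)"

text \<open>The real part is only a cast to \<^typ>\<open>real\<close> below: since the polynomial has real
  coefficients, every power trace is real (lemma \<open>admissible_power_trace_real\<close>).
  Lists are indexed from 0, so the Perron value is the entry at index 0.\<close>

definition admissible :: "complex list \<Rightarrow> bool" where
  "admissible \<Lambda> \<longleftrightarrow>
     2 \<le> length \<Lambda> \<and> 0 \<notin> set \<Lambda> \<and>
     \<Lambda> ! 0 = 1 \<and> (\<forall>i. 1 \<le> i \<and> i < length \<Lambda> \<longrightarrow> cmod (\<Lambda> ! i) < 1) \<and>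
     (\<forall>i. coeff (root_poly \<Lambda>) i \<in> \<real>) \<and>
     0 \<le> Re (power_trace \<Lambda> 1) \<and>
     (\<forall>k\<ge>2. 0 < Re (power_trace \<Lambda> k))"

definition tracial_floor :: "complex list \<Rightarrow> real" where
  "tracial_floor \<Lambda> = (INF k\<in>{2..}. Re (power_trace \<Lambda> k))"

lemma root_poly_cnj: "map_poly cnj (root_poly \<Lambda>) = root_poly (map cnj \<Lambda>)"
proof (induction \<Lambda>)
  case (Cons z \<Lambda>)
  have "map_poly cnj ([:- z, 1:] * p) = [:- cnj z, 1:] * map_poly cnj p" for p
    by (rule poly_eqI) (auto simp: coeff_map_poly coeff_pCons split: nat.split)
  then show ?case using Cons by (simp add: root_poly_def)
qed (simp add: root_poly_def map_poly_1)

lemma root_poly_eq_imp_mset_eq: "root_poly xs = root_poly ys \<Longrightarrow> mset xs = mset ys"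
proof (induction xs arbitrary: ys)
  case Nil
  show ?case
  proof (cases ys)
    case (Cons y zs)
    have "poly (root_poly ys) y = 0" by (simp add: root_poly_def Cons)
    then show ?thesis using Nil by (metis poly_1 root_poly_def list.map(1) prod_list.Nil zero_neq_one)
  qed simp
next
  case (Cons x xs)
  have "poly (root_poly ys) x = 0"
    unfolding Cons.prems[symmetric] by (simp add: root_poly_def)
  then have x: "x \<in> set ys"
    by (induction ys) (auto simp: root_poly_def)
  have split: "root_poly ys = [:- x, 1:] * root_poly (remove1 x ys)"
    using x
  proof (induction ys)
    case (Cons y zs)
    then show ?case by (cases "x = y") (auto simp: root_poly_def mult.left_commute simp del: mult_pCons_left mult_pCons_right)
  qed simp
  have "[:- x, 1:] * root_poly xs = [:- x, 1:] * root_poly (remove1 x ys)"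
    using Cons.prems unfolding split by (simp add: root_poly_def del: mult_pCons_left mult_pCons_right)
  then have "root_poly xs = root_poly (remove1 x ys)"
    by (metis mult_left_cancel pCons_eq_0_iff one_neq_zero)
  then have "mset xs = mset (remove1 x ys)" by (rule Cons.IH)
  then show ?case using x by simp
qed

lemma admissible_power_trace_real:
  assumes "admissible \<Lambda>"
  shows "power_trace \<Lambda> k \<in> \<real>"
proof -
  have "map_poly cnj (root_poly \<Lambda>) = root_poly \<Lambda>"
    using assms by (intro poly_eqI) (auto simp: admissible_def coeff_map_poly Reals_cnj_iff)
  then have "mset (map cnj \<Lambda>) = mset \<Lambda>"
    by (intro root_poly_eq_imp_mset_eq) (simp add: root_poly_cnj)
  then have "mset (map (\<lambda>z. z ^ k) (map cnj \<Lambda>)) = mset (map (\<lambda>z. z ^ k) \<Lambda>)"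
    by (metis mset_map)
  then have "sum_list (map (\<lambda>z. z ^ k) (map cnj \<Lambda>)) = sum_list (map (\<lambda>z. z ^ k) \<Lambda>)"
    by (metis sum_mset_sum_list)
  moreover have "sum_list (map (\<lambda>z. z ^ k) (map cnj \<Lambda>)) = cnj (power_trace \<Lambda> k)"
    by (induction \<Lambda>) (auto simp: power_trace_def)
  ultimately show ?thesis by (simp add: power_trace_def Reals_cnj_iff)
qed

lemma admissible_tracial_floor_nonneg: "admissible \<Lambda> \<Longrightarrow> 0 \<le> tracial_floor \<Lambda>"
  unfolding tracial_floor_def admissible_def by (rule cINF_greatest) (auto intro: less_imp_le)

end

(* Take the spectra (1, s, z, cnj z) with z = (-3 + i)/5 and s < 1 tending to 1.  Since
   1 + 2 Re z < 0 while 2 |z|^2 = 4/5 < s^2, they are admissible and have tracial floor 1.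

   Suppose that matrices of size at most N realize all of them.  Scaling by the Perron vector makes
   these matrices stochastic without changing their characteristic polynomials, so a subsequence
   converges to a stochastic matrix B with nonzero spectrum (1, 1, z, cnj z).  The eigenvectors
   for s, normalized to have oscillation 1, are bounded and converge to a nonconstant vector fixed
   by B.  The indices where that vector is maximal form a closed class, so B is block triangular.
   Both diagonal blocks have the eigenvalue 1, hence each has it once; z and cnj z are eigenvalues of
   the same block, which is nonnegative and yet has trace 1 + 2 Re z < 0. *)

theory Submission
  imports Defs "Jordan_Normal_Form.Spectral_Radius" "HOL-Real_Asymp.Real_Asymp"
begin

section \<open>Sign of the trace coefficient of a nonnegative matrix\<close>

text \<open>The coefficient in question is minus the trace; the formula for the derivative of the
  characteristic polynomial gives its sign by induction.\<close>

lemma coeff_char_poly_nonneg_mat: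
  fixes A :: "real mat"
  assumes "A \<in> carrier_mat (Suc n) (Suc n)"
    and "\<And>i j. i \<le> n \<Longrightarrow> j \<le> n \<Longrightarrow> 0 \<le> A $$ (i, j)"
  shows "coeff (char_poly A) n \<le> 0"
  using assms
proof (induction n arbitrary: A)
  case 0
  have "char_poly A = [:- (A $$ (0, 0)), 1:]"
    using 0(1) by (simp add: char_poly_defs det_single[of _] det_def)
  then show ?case using 0(2)[of 0 0] by simp
next
  case (Suc n)
  have "coeff (char_poly (mat_delete A i i)) n \<le> 0" if "i < Suc (Suc n)" for i
    using Suc.prems that
    by (intro Suc.IH) (auto simp: mat_delete_def)
  then have "(\<Sum>i<Suc (Suc n). coeff (char_poly (mat_delete A i i)) n) \<le> 0"
    by (intro sum_nonpos) auto
  also have "(\<Sum>i<Suc (Suc n). coeff (char_poly (mat_delete A i i)) n)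
      = coeff (pderiv (char_poly A)) n"
    by (simp only: pderiv_char_poly[OF Suc.prems(1)] coeff_sum)
  also have "\<dots> = real (Suc n) * coeff (char_poly A) (Suc n)"
    by (simp add: coeff_pderiv)
  finally show ?case by (simp add: mult_le_0_iff)
qed

section \<open>Real factorizations involving the quadratic factor\<close>

text \<open>The minimal polynomial of \<open>(-3 \<plusminus> \<i>)/5\<close>.\<close>

definition quad :: "real poly" where "quad = [:2/5, 6/5, 1:]"

text \<open>\<open>quad\<close> has negative discriminant, so it is irreducible over the reals and
  hence prime. Only the remainders modulo \<open>quad\<close> matter. They are at most linear, so a
  product of two of them divisible by \<open>quad\<close> is a constant multiple \<open>e\<close> of
  \<open>quad\<close>; comparing discriminants forces \<open>e = 0\<close>.\<close>

lemma quad_dvd_mult: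
  fixes P Q :: "real poly"
  assumes "quad dvd P * Q"
  shows "quad dvd P \<or> quad dvd Q"
proof -
  have r: "\<exists>a b. P mod quad = [:a, b:]" for P :: "real poly"
  proof -
    have "P mod quad = 0 \<or> degree (P mod quad) < 2"
      using degree_mod_less[of quad P] by (simp add: quad_def numeral_2_eq_2)
    then have "degree (P mod quad) \<le> 1" by auto
    then show ?thesis
      by (intro exI[of _ "coeff (P mod quad) 0"] exI[of _ "coeff (P mod quad) 1"] poly_eqI)
        (auto simp: coeff_pCons coeff_eq_0 split: nat.split)
  qed
  obtain a b where P: "P mod quad = [:a, b:]" using r by blast
  obtain c d where Q: "Q mod quad = [:c, d:]" using r by blast
  have "quad dvd [:a, b:] * [:c, d:]"
    using assms unfolding P[symmetric] Q[symmetric]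
    by (simp add: mod_eq_0_iff_dvd[symmetric] mod_mult_eq)
  then obtain R where R: "[:a, b:] * [:c, d:] = quad * R" by (elim dvdE)
  have "degree (quad * R) \<le> 2"
    unfolding R[symmetric] using degree_mult_le[of "[:a,b:]" "[:c,d:]"]
    by (auto split: if_splits)
  then have "degree R = 0"
  proof (cases "R = 0")
    case False
    moreover have "quad \<noteq> 0" "degree quad = 2" by (simp_all add: quad_def)
    ultimately show ?thesis using \<open>degree (quad * R) \<le> 2\<close> degree_mult_eq[of quad R] by simp
  qed simp
  then obtain e where "R = [:e:]" by (elim degree_eq_zeroE)
  with R have e: "b * d = e" "a * c = 2/5 * e" "a * d + b * c = 6/5 * e"
    by (auto simp: quad_def algebra_simps)
  \<comment> \<open>The discriminant of a product of two real linear factors is a square, yet here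
    it equals \<open>e\<close> squared times the discriminant -4/25 of \<open>quad\<close>.\<close>
  have "(a * d - b * c)\<^sup>2 = (a * d + b * c)\<^sup>2 - 4 * (a * c) * (b * d)"
    by (simp add: power2_eq_square algebra_simps)
  also have "\<dots> = - (4/25) * e\<^sup>2"
    unfolding e by (simp add: power2_eq_square algebra_simps)
  finally have "e = 0"
    using zero_le_power2[of "a*d - b*c"] by (cases "e = 0") (auto simp: mult_less_0_iff)
  with e have "(a = 0 \<and> b = 0) \<or> (c = 0 \<and> d = 0)" by auto
  then show ?thesis
    using P Q by (auto simp: mod_eq_0_iff_dvd[symmetric])
qed

text \<open>At least one of the two factors vanishes at 0; each induction step strips one power of
  the variable from that factor.\<close>

lemma monic_dvd_monom:
  fixes R S :: "real poly"
  assumes "R * S = monom 1 j" "lead_coeff R = 1"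
  shows "\<exists>a. R = monom 1 a"
  using assms
proof (induction j arbitrary: R S)
  case 0
  then have "R dvd 1" by (metis dvd_triv_left monom_eq_1)
  then have "degree R = 0" by (simp add: poly_dvd_1)
  then have "R = monom 1 0" using 0(2) by (metis degree_eq_zeroE lead_coeff_pCons(2) monom_0)
  then show ?case by blast
next
  case (Suc j)
  have shift: "U * V = monom 1 j" if "pCons 0 U * V = monom 1 (Suc j)" for U V :: "real poly"
    using that by (simp add: monom_Suc)
  have "coeff R 0 * coeff S 0 = 0"
    by (metis Suc.prems(1) coeff_mult_0 coeff_monom nat.distinct(1))
  then consider "coeff R 0 = 0" | "coeff S 0 = 0" by auto
  then show ?case
  proof cases
    case 1
    then obtain U where U: "R = pCons 0 U" by (cases R) auto
    have "U \<noteq> 0" using U Suc.prems(2) by auto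
    with U Suc.prems have "lead_coeff U = 1" by simp
    moreover have "U * S = monom 1 j" using Suc.prems(1) U by (intro shift) simp
    ultimately obtain a where "U = monom 1 a" using Suc.IH by blast
    then show ?thesis using U by (intro exI[of _ "Suc a"]) (simp add: monom_Suc)
  next
    case 2
    then obtain U where U: "S = pCons 0 U" by (cases S) auto
    then have "R * U = monom 1 j" using Suc.prems(1) shift[of U R] by (simp add: mult.commute)
    then show ?thesis using Suc by blast
  qed
qed

text \<open>\<open>P\<close> and \<open>Q\<close> stand for the characteristic polynomials of the
  two diagonal blocks. Each uses up one of the two factors \<open>[:-1, 1:]\<close>, and
  \<open>quad\<close>, being prime, goes undivided to one of them. What remains of that polynomial
  is a power of the variable, so its second highest coefficient is 1/5, against
  \<open>nz\<close>.\<close>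

lemma char_poly_factors_absurd:
  fixes P Q :: "real poly"
  assumes eq: "P * Q = monom 1 j * ([:-1, 1:] * ([:-1, 1:] * quad))"
    and roots: "poly P 1 = 0" "poly Q 1 = 0"
    and lc: "lead_coeff P = 1" "lead_coeff Q = 1"
    and nz: "coeff P (degree P - 1) \<le> 0" "coeff Q (degree Q - 1) \<le> 0"
  shows False
proof -
  \<comment> \<open>The coefficient 1/5 is minus the sum of the three roots 1 and (-3 +- i)/5;
    multiplying by a monomial only shifts it.\<close>
  have factor: "[:-1, 1:] * quad = [:-(2/5), -(4/5), 1/5, 1:]" by (simp add: quad_def)
  \<comment> \<open>Stated for arbitrary \<open>P\<close>, \<open>R\<close>, \<open>S\<close>, so
    that it serves whichever of the two factors receives \<open>quad\<close>.\<close>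
  have key: False
    if PR: "P = [:-1, 1:] * (quad * R)" and RS: "R * S = monom 1 j"
      and lcP: "lead_coeff P = 1" and nzP: "coeff P (degree P - 1) \<le> 0" for P R S
  proof -
    have "lead_coeff R = 1"
      using PR lcP by (simp only: lead_coeff_mult) (simp add: quad_def)
    then obtain a where R: "R = monom 1 a" using monic_dvd_monom RS by blast
    then have P: "P = monom 1 a * [:-(2/5), -(4/5), 1/5, 1:]"
      unfolding PR R by (simp only: factor mult.assoc[symmetric]) (simp only: mult.commute)
    have "degree P = a + 3" unfolding P by (subst degree_mult_eq) (auto simp: degree_monom_eq)
    moreover have "coeff P (a + 2) = 1/5" unfolding P coeff_monom_mult by (simp add: numeral_2_eq_2)
    ultimately show False using nzP by simp
  qed
  obtain P1 where P1: "P = [:-1, 1:] * P1" using roots(1) by (metis dvdE poly_eq_0_iff_dvd)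
  obtain Q1 where Q1: "Q = [:-1, 1:] * Q1" using roots(2) by (metis dvdE poly_eq_0_iff_dvd)
  have "[:-1, 1:] * ([:-1, 1:] * (P1 * Q1)) = [:-1, 1:] * ([:-1, 1:] * (monom 1 j * quad))"
    using eq unfolding P1 Q1 by (simp only: mult_ac)
  then have PQ: "P1 * Q1 = monom 1 j * quad"
    using mult_left_cancel[of "[:-1, 1:] :: real poly"] by (metis pCons_eq_0_iff one_neq_zero)
  have c0: "quad \<noteq> 0" by (simp add: quad_def)
  from PQ consider "quad dvd P1" | "quad dvd Q1" using quad_dvd_mult by (metis dvd_triv_right)
  then show False
  proof cases
    case 1
    then obtain R where R: "P1 = quad * R" by (elim dvdE)
    have "quad * (R * Q1) = quad * monom 1 j" using PQ unfolding R by (simp only: mult_ac)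
    then have "R * Q1 = monom 1 j" using c0 by simp
    then show False using key P1 R lc(1) nz(1) by blast
  next
    case 2
    then obtain R where R: "Q1 = quad * R" by (elim dvdE)
    have "quad * (R * P1) = quad * monom 1 j" using PQ unfolding R by (simp only: mult_ac)
    then have "R * P1 = monom 1 j" using c0 by simp
    then show False using key Q1 R lc(2) nz(2) by blast
  qed
qed

section \<open>Characteristic polynomials of permuted and block triangular matrices\<close>

text \<open>Permuting the rows of the characteristic matrix by \<open>p\<close>, and then its
  columns by way of transposition, multiplies the determinant by \<open>signof p\<close>
  twice.\<close>

lemma char_poly_permute:
  fixes A :: "'a :: idom mat"
  assumes A: "A \<in> carrier_mat n n" and p: "p permutes {0..<n}"
  shows "char_poly (mat n n (\<lambda>(i, j). A $$ (p i, p j))) = char_poly A"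
proof -
  define M where "M = char_poly_matrix A"
  have M: "M \<in> carrier_mat n n" using A by (simp add: M_def)
  define N where "N = mat n n (\<lambda>(i, j). M $$ (p i, j))"
  have N: "N \<in> carrier_mat n n" by (simp add: N_def)
  have pn: "p i < n" if "i < n" for i using permutes_in_image[OF p, of i] that by simp
  have pi: "p i = p j \<longleftrightarrow> i = j" for i j using permutes_inj[OF p] by (auto dest: injD)
  have "char_poly_matrix (mat n n (\<lambda>(i, j). A $$ (p i, p j)))
      = transpose_mat (mat n n (\<lambda>(i, j). (transpose_mat N) $$ (p i, j)))"
    using A pn by (intro eq_matI) (auto simp: char_poly_matrix_def N_def M_def pi)
  then have "char_poly (mat n n (\<lambda>(i, j). A $$ (p i, p j)))
      = det (mat n n (\<lambda>(i, j). (transpose_mat N) $$ (p i, j)))"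
    unfolding char_poly_def by (simp add: det_transpose[of _ n])
  also have "\<dots> = signof p * det N"
    using N by (subst det_permute_rows[OF _ p]) (simp_all add: det_transpose[of _ n])
  also have "det N = signof p * det M"
    unfolding N_def by (rule det_permute_rows[OF M p])
  also have "signof p * (signof p * det M) = det M"
    by (simp add: sign_def)
  finally show ?thesis by (simp add: M_def char_poly_def)
qed

lemma char_poly_four_block_upper_right_zero:
  fixes C :: "'a :: idom mat"
  assumes C: "C \<in> carrier_mat m m" and X: "X \<in> carrier_mat k m" and D: "D \<in> carrier_mat k k"
  shows "char_poly (four_block_mat C (0\<^sub>m m k) X D) = char_poly C * char_poly D"
proof -
  have "char_poly_matrix (four_block_mat C (0\<^sub>m m k) X D)
      = four_block_mat (char_poly_matrix C) (0\<^sub>m m k) (map_mat (\<lambda>a. [:- a:]) X) (char_poly_matrix D)"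
    using assms by (intro eq_matI) (auto simp: char_poly_matrix_def)
  then show ?thesis
    unfolding char_poly_def using assms
    by (simp add: det_four_block_mat_upper_right_zero[of _ m _ k])
qed

text \<open>This serves to list the indices of a closed class first, which makes the matrix block
  triangular.\<close>

lemma exists_permutation_onto:
  assumes "S \<subseteq> {0..<n::nat}"
  obtains p where "p permutes {0..<n}" "\<And>i. i < n \<Longrightarrow> p i \<in> S \<longleftrightarrow> i < card S"
proof -
  have fS: "finite S" using assms finite_subset by blast
  have le: "card S \<le> n" using card_mono[OF _ assms] by simp
  obtain f where f: "bij_betw f {0..<card S} S"
    using ex_bij_betw_nat_finite[OF fS] by blast
  have "card ({0..<n} - S) = n - card S" using assms fS by (simp add: card_Diff_subset)
  then obtain g where g: "bij_betw g {card S..<n} ({0..<n} - S)"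
    using finite_same_card_bij[of "{card S..<n}" "{0..<n} - S"] by auto
  define p where "p i = (if i < card S then f i else if i < n then g i else i)" for i
  have pf: "bij_betw p {0..<card S} S"
    using f by (subst bij_betw_cong[of _ _ f]) (auto simp: p_def)
  have pg: "bij_betw p {card S..<n} ({0..<n} - S)"
    using g by (subst bij_betw_cong[of _ _ g]) (auto simp: p_def)
  have "bij_betw p ({0..<card S} \<union> {card S..<n}) (S \<union> ({0..<n} - S))"
    by (rule bij_betw_combine[OF pf pg]) auto
  moreover have "{0..<card S} \<union> {card S..<n} = {0..<n}" "S \<union> ({0..<n} - S) = {0..<n}"
    using le assms by auto
  ultimately have "bij_betw p {0..<n} {0..<n}" by simp
  then have "p permutes {0..<n}"
    by (rule bij_imp_permutes) (use le in \<open>auto simp: p_def\<close>)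
  moreover have "p i \<in> S \<longleftrightarrow> i < card S" if "i < n" for i
    using bij_betwE[OF pf] bij_betwE[OF pg] that
    by (cases "i < card S") auto
  ultimately show thesis using that by blast
qed

section \<open>Stochastic matrices that fix a nonconstant vector\<close>

definition stochastic :: "nat \<Rightarrow> real mat \<Rightarrow> bool" where
  "stochastic n B \<longleftrightarrow> B \<in> carrier_mat n n \<and> (\<forall>i<n. \<forall>j<n. 0 \<le> B $$ (i, j)) \<and>
     (\<forall>i<n. (\<Sum>j<n. B $$ (i, j)) = 1)"

lemma root_char_polyI:
  fixes A :: "'a :: field mat"
  assumes A: "A \<in> carrier_mat n n" and ev: "\<And>i. i < n \<Longrightarrow> (\<Sum>j<n. A $$ (i, j) * w j) = e * w i"
    and nz: "l < n" "w l \<noteq> 0"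
  shows "poly (char_poly A) e = 0"
proof -
  have "A *\<^sub>v vec n w = e \<cdot>\<^sub>v vec n w"
    using A ev by (intro eq_vecI) (auto simp: scalar_prod_def lessThan_atLeast0)
  moreover have "vec n w \<noteq> 0\<^sub>v n"
    using nz by (metis index_vec index_zero_vec(1))
  ultimately have "eigenvector A (vec n w) e"
    using A by (auto simp: eigenvector_def)
  then show ?thesis using eigenvalue_root_char_poly[OF A] by (auto simp: eigenvalue_def)
qed

text \<open>The maximal value \<open>v i\<close> is a weighted average of the values
  \<open>v j\<close>. The terms \<open>B $$ (i, j) * (v i - v j)\<close> are nonnegative and sum to
  zero, so no weight falls on a smaller value.\<close>

lemma stochastic_harmonic_max_closed:
  assumes B: "stochastic n B" and harm: "(\<Sum>j<n. B $$ (i, j) * v j) = v i"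
    and max: "\<And>j. j < n \<Longrightarrow> v j \<le> v i" and i: "i < n" and j: "j < n" "v j \<noteq> v i"
  shows "B $$ (i, j) = 0"
proof -
  have "(\<Sum>j<n. B $$ (i, j) * (v i - v j)) = (\<Sum>j<n. B $$ (i, j)) * v i - (\<Sum>j<n. B $$ (i, j) * v j)"
    by (simp add: right_diff_distrib sum_subtractf sum_distrib_right)
  also have "\<dots> = 0" using B harm i by (simp add: stochastic_def)
  finally have "(\<Sum>j<n. B $$ (i, j) * (v i - v j)) = 0" .
  then have "\<forall>j\<in>{..<n}. B $$ (i, j) * (v i - v j) = 0"
    using B i max by (subst (asm) sum_nonneg_eq_0_iff) (auto simp: stochastic_def)
  then show ?thesis using j by auto
qed

text \<open>The set \<open>S\<close> where \<open>v\<close> attains its maximum \<open>M\<close> is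
  closed, nonempty and proper. With \<open>S\<close> listed first the upper right block vanishes,
  and the characteristic polynomial splits. The sizes are written as successors to record that
  neither block is empty.\<close>

lemma stochastic_harmonic_split:
  assumes B: "stochastic n B" and harm: "\<And>i. i < n \<Longrightarrow> (\<Sum>j<n. B $$ (i, j) * v j) = v i"
    and nc: "a < n" "b < n" "v a < v b"
  obtains m k C D where "C \<in> carrier_mat (Suc m) (Suc m)" "D \<in> carrier_mat (Suc k) (Suc k)"
    "\<And>i j. i \<le> m \<Longrightarrow> j \<le> m \<Longrightarrow> 0 \<le> C $$ (i, j)"
    "\<And>i j. i \<le> k \<Longrightarrow> j \<le> k \<Longrightarrow> 0 \<le> D $$ (i, j)"
    "char_poly B = char_poly C * char_poly D" "poly (char_poly C) 1 = 0" "poly (char_poly D) 1 = 0"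
proof -
  have Bc: "B \<in> carrier_mat n n" using B by (simp add: stochastic_def)
  define M where "M = Max (v ` {..<n})"
  have Mge: "v i \<le> M" if "i < n" for i using that by (simp add: M_def)
  have "M \<in> v ` {..<n}" unfolding M_def using nc by (intro Max_in) auto
  then obtain c where c: "c < n" "v c = M" by auto
  define S where "S = {i. i < n \<and> v i = M}"
  have SS: "S \<subseteq> {0..<n}" by (auto simp: S_def)
  have fS: "finite S" using SS finite_subset by blast
  obtain p where p: "p permutes {0..<n}" and pS: "\<And>i. i < n \<Longrightarrow> p i \<in> S \<longleftrightarrow> i < card S"
    using exists_permutation_onto[OF SS] by metis
  have pn: "p i < n" if "i < n" for i using permutes_in_image[OF p, of i] that by simp
  have "c \<in> S" using c by (simp add: S_def)
  then have S0: "0 < card S" using fS by (auto simp: card_gt_0_iff)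
  have aS: "a \<notin> S" using nc Mge[of b] by (auto simp: S_def)
  then have "S \<subset> {0..<n}" using SS nc by auto
  then have Sn: "card S < n" using psubset_card_mono[of "{0..<n}" S] by simp
  define m where "m = card S"
  define k where "k = n - m"
  have mk: "n = m + k" "0 < m" "0 < k" using S0 Sn by (auto simp: m_def k_def)
  have low: "v (p i) = M" if "i < m" for i
  proof -
    have "i < n" using that mk by simp
    then have "p i \<in> S" using pS that by (simp add: m_def)
    then show ?thesis by (simp add: S_def)
  qed
  have high: "v (p i) \<noteq> M" if "m \<le> i" "i < n" for i
  proof -
    have "p i \<notin> S" using pS that by (simp add: m_def)
    then show ?thesis using pn that by (simp add: S_def)
  qed
  define P where "P = mat n n (\<lambda>(i, j). B $$ (p i, p j))"
  define C where "C = mat m m (\<lambda>(i, j). B $$ (p i, p j))"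
  define D where "D = mat k k (\<lambda>(i, j). B $$ (p (i + m), p (j + m)))"
  define X where "X = mat k m (\<lambda>(i, j). B $$ (p (i + m), p j))"
  have zero: "B $$ (p i, p j) = 0" if "i < m" "m \<le> j" "j < n" for i j
  proof (rule stochastic_harmonic_max_closed[OF B])
    show "p i < n" "p j < n" using that mk pn by simp_all
    then show "(\<Sum>l<n. B $$ (p i, l) * v l) = v (p i)" by (simp add: harm)
    show "v l \<le> v (p i)" if "l < n" for l using Mge[OF that] low[OF \<open>i < m\<close>] by simp
    show "v (p j) \<noteq> v (p i)" using low high that by simp
  qed
  have "P = four_block_mat C (0\<^sub>m m k) X D"
    using mk by (intro eq_matI) (auto simp: P_def C_def D_def X_def zero)
  then have cp: "char_poly B = char_poly C * char_poly D"
    using char_poly_permute[OF Bc p]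
    by (simp add: P_def[symmetric] char_poly_four_block_upper_right_zero C_def D_def X_def)
  have reindex: "(\<Sum>j<n. h (p j)) = (\<Sum>j<n. h j)" for h :: "nat \<Rightarrow> real"
    using sum.permute[OF p, of h] by (simp add: lessThan_atLeast0 comp_def)
  have tail: "(\<Sum>j<n. h j) = (\<Sum>j<m. h j) + (\<Sum>j<k. h (j + m))" for h :: "nat \<Rightarrow> real"
    unfolding mk(1) by (induction k) (simp_all add: add.commute)
  \<comment> \<open>The rows of \<open>C\<close> keep their full sum 1, so \<open>C\<close> fixes
    the constant vector.\<close>
  have rootC: "poly (char_poly C) 1 = 0"
  proof (rule root_char_polyI[where w = "\<lambda>_. 1" and l = 0])
    fix i assume i: "i < m"
    have "1 = (\<Sum>j<n. B $$ (p i, j))" using B pn[of i] i mk by (simp add: stochastic_def)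
    also have "\<dots> = (\<Sum>j<n. B $$ (p i, p j))" by (rule reindex[symmetric])
    also have "\<dots> = (\<Sum>j<m. B $$ (p i, p j))"
      unfolding tail[of "\<lambda>j. B $$ (p i, p j)"] using i mk by (simp add: zero)
    finally show "(\<Sum>j<m. C $$ (i, j) * 1) = 1 * 1" using i by (simp add: C_def)
  qed (use mk in \<open>auto simp: C_def\<close>)
  \<comment> \<open>The vector \<open>v - M\<close> is also fixed by \<open>B\<close> and vanishes
    on \<open>S\<close>, so its restriction to the complement is fixed by \<open>D\<close>. It is
    nonzero there because \<open>v\<close> is never \<open>M\<close> outside
    \<open>S\<close>.\<close>
  have rootD: "poly (char_poly D) 1 = 0"
  proof (rule root_char_polyI[where w = "\<lambda>j. v (p (j + m)) - M" and l = 0])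
    fix i assume i: "i < k"
    let ?i = "p (i + m)"
    have pi: "?i < n" using i mk pn by simp
    have "v ?i - M = (\<Sum>j<n. B $$ (?i, j) * v j) - (\<Sum>j<n. B $$ (?i, j)) * M"
      using B pi harm by (simp add: stochastic_def)
    also have "\<dots> = (\<Sum>j<n. B $$ (?i, j) * (v j - M))"
      by (simp add: right_diff_distrib sum_subtractf sum_distrib_right)
    also have "\<dots> = (\<Sum>j<n. B $$ (?i, p j) * (v (p j) - M))" by (rule reindex[symmetric])
    also have "\<dots> = (\<Sum>j<k. B $$ (?i, p (j + m)) * (v (p (j + m)) - M))"
      unfolding tail[of "\<lambda>j. B $$ (?i, p j) * (v (p j) - M)"] by (simp add: low)
    finally show "(\<Sum>j<k. D $$ (i, j) * (v (p (j + m)) - M)) = 1 * (v ?i - M)"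
      using i by (simp add: D_def)
  qed (use mk high[of m] in \<open>auto simp: D_def\<close>)
  obtain m' k' where "m = Suc m'" "k = Suc k'" using mk by (metis gr0_implies_Suc)
  moreover have "0 \<le> B $$ (p i, p j)" if "i < n" "j < n" for i j
    using B pn that by (simp add: stochastic_def)
  ultimately show thesis
    using cp rootC rootD mk by (intro that[of C m' D k']) (auto simp: C_def D_def)
qed

lemma stochastic_char_poly_neq:
  assumes B: "stochastic n B" and harm: "\<And>i. i < n \<Longrightarrow> (\<Sum>j<n. B $$ (i, j) * v j) = v i"
    and nc: "a < n" "b < n" "v a \<noteq> v b"
  shows "char_poly B \<noteq> monom 1 j * ([:-1, 1:] * ([:-1, 1:] * quad))"
proof
  assume eq: "char_poly B = monom 1 j * ([:-1, 1:] * ([:-1, 1:] * quad))"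
  obtain a b where ab: "a < n" "b < n" "v a < v b" using nc by (metis linorder_neqE)
  obtain m k C D where CD: "C \<in> carrier_mat (Suc m) (Suc m)" "D \<in> carrier_mat (Suc k) (Suc k)"
    "\<And>i j. i \<le> m \<Longrightarrow> j \<le> m \<Longrightarrow> 0 \<le> C $$ (i, j)"
    "\<And>i j. i \<le> k \<Longrightarrow> j \<le> k \<Longrightarrow> 0 \<le> D $$ (i, j)"
    "char_poly B = char_poly C * char_poly D" "poly (char_poly C) 1 = 0" "poly (char_poly D) 1 = 0"
    using stochastic_harmonic_split[OF B harm ab] by metis
  show False
  proof (rule char_poly_factors_absurd)
    show "char_poly C * char_poly D = monom 1 j * ([:-1, 1:] * ([:-1, 1:] * quad))"
      using eq CD by simp
  qed (use CD degree_monic_char_poly[OF CD(1)] degree_monic_char_poly[OF CD(2)]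
      coeff_char_poly_nonneg_mat[OF CD(1)] coeff_char_poly_nonneg_mat[OF CD(2)] in auto)
qed

section \<open>Perron vectors and reduction to stochastic matrices\<close>

lemma mult_mat_vec_index_sum:
  assumes "A \<in> carrier_mat n n" "v \<in> carrier_vec n" "i < n"
  shows "(A *\<^sub>v v) $ i = (\<Sum>j<n. A $$ (i, j) * v $ j)"
  using assms by (auto simp: scalar_prod_def lessThan_atLeast0)

lemma pow_mat_mult_vec_commute:
  fixes A :: "'a :: comm_semiring_1 mat"
  assumes A: "A \<in> carrier_mat n n" and v: "v \<in> carrier_vec n"
  shows "A ^\<^sub>m m *\<^sub>v (A *\<^sub>v v) = A *\<^sub>v (A ^\<^sub>m m *\<^sub>v v)"
  using v
proof (induction m arbitrary: v)
  case 0
  then show ?case using A by simp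
next
  case (Suc m)
  have Am: "A ^\<^sub>m m \<in> carrier_mat n n" using A by simp
  have "A ^\<^sub>m Suc m *\<^sub>v (A *\<^sub>v v) = A ^\<^sub>m m *\<^sub>v (A *\<^sub>v (A *\<^sub>v v))"
    using assoc_mult_mat_vec[OF Am A, of "A *\<^sub>v v"] A Suc.prems by simp
  also have "\<dots> = A *\<^sub>v (A ^\<^sub>m m *\<^sub>v (A *\<^sub>v v))" using A Suc by simp
  also have "A ^\<^sub>m m *\<^sub>v (A *\<^sub>v v) = A ^\<^sub>m Suc m *\<^sub>v v"
    using assoc_mult_mat_vec[OF Am A, of v] Suc.prems by simp
  finally show ?case .
qed

lemma root_char_polyE:
  fixes A :: "'a :: field mat"
  assumes A: "A \<in> carrier_mat n n" and root: "poly (char_poly A) e = 0"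
  obtains v where "v \<in> carrier_vec n" "v \<noteq> 0\<^sub>v n" "A *\<^sub>v v = e \<cdot>\<^sub>v v"
proof -
  have "eigenvalue A e" using eigenvalue_root_char_poly[OF A] root by simp
  then show thesis using A that by (auto simp: eigenvalue_def eigenvector_def)
qed

text \<open>If all eigenvalues have modulus at most 1, the Jordan form bounds the entries of the
  powers polynomially; mere boundedness could fail, since Jordan blocks for eigenvalues of modulus 1
  are not excluded. A uniform gain \<open>1 + e\<close> on a positive vector would make the powers
  grow exponentially.\<close>

lemma spectral_radius_le_one_no_expansion:
  fixes A :: "real mat"
  assumes A: "A \<in> carrier_mat n n" and n: "0 < n"
    and nonneg: "\<And>i j. i < n \<Longrightarrow> j < n \<Longrightarrow> 0 \<le> A $$ (i, j)"
    and roots: "\<And>z. poly (map_poly complex_of_real (char_poly A)) z = 0 \<Longrightarrow> cmod z \<le> 1"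
    and x: "x \<in> carrier_vec n" and x0: "\<And>i. i < n \<Longrightarrow> 0 < x $ i"
    and e: "0 < e" and grow: "\<And>i. i < n \<Longrightarrow> (1 + e) * x $ i \<le> (A *\<^sub>v x) $ i"
  shows False
proof -
  let ?C = "map_mat complex_of_real A"
  have C: "?C \<in> carrier_mat n n" using A by simp
  have cp: "char_poly ?C = map_poly complex_of_real (char_poly A)"
    by (rule of_real_hom.char_poly_hom[OF A])
  have pow: "?C ^\<^sub>m m = map_mat complex_of_real (A ^\<^sub>m m)" for m
    by (rule of_real_hom.mat_hom_pow[OF A, symmetric])
  have "spectral_radius ?C \<in> cmod ` spectrum ?C"
    by (rule spectral_radius_mem_max(1)[OF C n])
  then obtain z where "z \<in> spectrum ?C" "spectral_radius ?C = cmod z" by auto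
  then have "spectral_radius ?C \<le> 1"
    using roots eigenvalue_root_char_poly[OF C] by (auto simp: spectrum_def cp)
  from spectral_radius_jnf_norm_bound_le_1_upper_triangular[OF C this]
  obtain c1 c2 where bound: "\<And>m. norm_bound (?C ^\<^sub>m m) (c1 + c2 * of_nat m ^ (n - 1))" by blast
  have entry: "(A ^\<^sub>m m) $$ (i, j) \<le> c1 + c2 * of_nat m ^ (n - 1)" if "i < n" "j < n" for i j m
  proof -
    have Am: "A ^\<^sub>m m \<in> carrier_mat n n" using A by simp
    have "cmod ((?C ^\<^sub>m m) $$ (i, j)) \<le> c1 + c2 * of_nat m ^ (n - 1)"
      using bound[of m] that A by (auto simp: norm_bound_def)
    then show ?thesis using that carrier_matD[OF Am] by (simp add: pow)
  qed
  \<comment> \<open>Nonnegativity of \<open>A\<close> preserves coordinatewise inequalities, so the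
    gain can be iterated.\<close>
  have lower: "(1 + e) ^ m * x $ i \<le> (A ^\<^sub>m m *\<^sub>v x) $ i" if "i < n" for i m
    using that
  proof (induction m arbitrary: i)
    case 0
    then show ?case using A x by simp
  next
    case (Suc m)
    let ?y = "A ^\<^sub>m m *\<^sub>v x"
    have y: "?y \<in> carrier_vec n" using A x by (meson mult_mat_vec_carrier pow_carrier_mat)
    have Am: "A ^\<^sub>m m \<in> carrier_mat n n" using A by simp
    have "(1 + e) ^ Suc m * x $ i = (1 + e) ^ m * ((1 + e) * x $ i)" by simp
    also have "\<dots> \<le> (1 + e) ^ m * (A *\<^sub>v x) $ i"
      using grow[OF Suc.prems] e by (intro mult_left_mono) auto
    also have "\<dots> = (\<Sum>j<n. A $$ (i, j) * ((1 + e) ^ m * x $ j))"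
      by (simp add: mult_mat_vec_index_sum[OF A x Suc.prems] sum_distrib_left mult_ac)
    also have "\<dots> \<le> (\<Sum>j<n. A $$ (i, j) * ?y $ j)"
      using Suc nonneg by (intro sum_mono mult_left_mono) auto
    also have "\<dots> = (A *\<^sub>v ?y) $ i"
      by (rule mult_mat_vec_index_sum[OF A y Suc.prems, symmetric])
    also have "A *\<^sub>v ?y = A ^\<^sub>m Suc m *\<^sub>v x"
      using pow_mat_mult_vec_commute[OF A x, of m] assoc_mult_mat_vec[OF Am A x] by simp
    finally show ?case .
  qed
  define s where "s = (\<Sum>j<n. x $ j)"
  have ineq: "(1 + e) ^ m * x $ 0 \<le> (c1 + c2 * of_nat m ^ (n - 1)) * s" for m
  proof -
    have Am: "A ^\<^sub>m m \<in> carrier_mat n n" using A by simp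
    have "(1 + e) ^ m * x $ 0 \<le> (A ^\<^sub>m m *\<^sub>v x) $ 0" using lower n by simp
    also have "\<dots> = (\<Sum>j<n. (A ^\<^sub>m m) $$ (0, j) * x $ j)"
      by (rule mult_mat_vec_index_sum[OF Am x n])
    also have "\<dots> \<le> (\<Sum>j<n. (c1 + c2 * of_nat m ^ (n - 1)) * x $ j)"
      using entry n x0 by (intro sum_mono mult_right_mono) (auto intro: less_imp_le)
    finally show ?thesis by (simp add: s_def sum_distrib_left)
  qed
  have "((\<lambda>m. (c1 + c2 * of_nat m ^ (n - 1)) * s / (1 + e) ^ m) \<longlongrightarrow> 0) sequentially"
    using e by real_asymp
  then have "x $ 0 \<le> 0"
  proof (rule tendsto_lowerbound)
    show "\<forall>\<^sub>F m in sequentially. x $ 0 \<le> (c1 + c2 * of_nat m ^ (n - 1)) * s / (1 + e) ^ m"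
      using ineq e by (intro always_eventually) (simp add: pos_le_divide_eq mult.commute)
  qed simp
  then show False using x0[OF n] by simp
qed

text \<open>The modulus \<open>\<bar>v\<bar>\<close> of a real eigenvector satisfies \<open>\<bar>v\<bar> \<le> A \<bar>v\<bar>\<close>.  If this were not an
  equality, \<open>A\<^sup>k\<close> would turn it into a strict inequality in every coordinate, and the powers of
  \<open>A\<close> would grow exponentially.\<close>

lemma primitive_perron_vector:
  fixes A :: "real mat"
  assumes A: "A \<in> carrier_mat n n"
    and nonneg: "\<And>i j. i < n \<Longrightarrow> j < n \<Longrightarrow> 0 \<le> A $$ (i, j)"
    and pos: "\<And>i j. i < n \<Longrightarrow> j < n \<Longrightarrow> 0 < (A ^\<^sub>m k) $$ (i, j)"
    and root: "poly (char_poly A) 1 = 0"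
    and roots: "\<And>z. poly (map_poly complex_of_real (char_poly A)) z = 0 \<Longrightarrow> cmod z \<le> 1"
  obtains x where "\<And>i. i < n \<Longrightarrow> 0 < x i" "\<And>i. i < n \<Longrightarrow> (\<Sum>j<n. A $$ (i, j) * x j) = x i"
proof -
  obtain v where v: "v \<in> carrier_vec n" "v \<noteq> 0\<^sub>v n" "A *\<^sub>v v = 1 \<cdot>\<^sub>v v"
    using root_char_polyE[OF A root] by blast
  define y where "y = vec n (\<lambda>i. \<bar>v $ i\<bar>)"
  have y: "y \<in> carrier_vec n" by (simp add: y_def)
  obtain c where c: "c < n" "v $ c \<noteq> 0"
    using v(1,2) by (metis carrier_vecD eq_vecI index_zero_vec)
  then have n: "0 < n" by simp
  have Ak: "A ^\<^sub>m k \<in> carrier_mat n n" using A by simp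
  have strict: "0 < (A ^\<^sub>m k *\<^sub>v u) $ i"
    if u: "u \<in> carrier_vec n" and u0: "\<And>j. j < n \<Longrightarrow> 0 \<le> u $ j" and d: "d < n" "0 < u $ d" and i: "i < n"
    for u d i
    unfolding mult_mat_vec_index_sum[OF Ak u i]
    using d u0 pos[OF i] by (intro sum_pos2[of _ d]) (auto intro!: mult_nonneg_nonneg less_imp_le[OF pos[OF i]])
  \<comment> \<open>Some coordinates of \<open>y\<close> might be zero, whereas positivity of the
    \<open>k\<close>-th power makes all those of \<open>x\<close> positive. This \<open>x\<close>
    serves both in the contradiction below and as the final Perron vector.\<close>
  define x where "x = A ^\<^sub>m k *\<^sub>v y"
  have x: "x \<in> carrier_vec n" using Ak y by (simp add: x_def)
  have x0: "0 < x $ i" if "i < n" for i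
    unfolding x_def using c that by (intro strict[OF y _ c(1)]) (auto simp: y_def)
  have Ay: "A *\<^sub>v y \<in> carrier_vec n" using A y by simp
  have sub: "y $ i \<le> (A *\<^sub>v y) $ i" if i: "i < n" for i
  proof -
    have "y $ i = \<bar>(A *\<^sub>v v) $ i\<bar>" using v i by (simp add: y_def)
    also have "\<dots> \<le> (\<Sum>j<n. \<bar>A $$ (i, j) * v $ j\<bar>)"
      unfolding mult_mat_vec_index_sum[OF A v(1) i] by (rule sum_abs)
    also have "\<dots> = (\<Sum>j<n. A $$ (i, j) * y $ j)"
      using nonneg i by (intro sum.cong) (auto simp: abs_mult y_def)
    finally show ?thesis by (simp only: mult_mat_vec_index_sum[OF A y i])
  qed
  have "A *\<^sub>v y = y"
  proof (rule ccontr)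
    assume ne: "A *\<^sub>v y \<noteq> y"
    then obtain d where "d < n" "(A *\<^sub>v y) $ d \<noteq> y $ d"
      using Ay y by (metis carrier_vecD eq_vecI)
    then have d: "d < n" "0 < (A *\<^sub>v y - y) $ d" using sub[of d] y by auto
    have diff: "A *\<^sub>v y - y \<in> carrier_vec n" using Ay y by simp
    have gain: "x $ i < (A *\<^sub>v x) $ i" if i: "i < n" for i
    proof -
      have "0 < (A ^\<^sub>m k *\<^sub>v (A *\<^sub>v y - y)) $ i"
        using sub y i by (intro strict[OF diff _ d]) auto
      also have "A ^\<^sub>m k *\<^sub>v (A *\<^sub>v y - y) = A *\<^sub>v x - x"
        unfolding x_def mult_minus_distrib_mat_vec[OF Ak Ay y] pow_mat_mult_vec_commute[OF A y] ..
      finally show ?thesis using x i by simp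
    qed
    \<comment> \<open>The least relative gain over the finitely many coordinates.\<close>
    define e where "e = Min ((\<lambda>i. (A *\<^sub>v x) $ i / x $ i - 1) ` {..<n})"
    have "0 < e" unfolding e_def
      using n gain x0 by (subst Min_gr_iff) (auto simp: pos_less_divide_eq)
    moreover have "(1 + e) * x $ i \<le> (A *\<^sub>v x) $ i" if "i < n" for i
    proof -
      have "e \<le> (A *\<^sub>v x) $ i / x $ i - 1" unfolding e_def using that by (intro Min_le) auto
      then have "1 + e \<le> (A *\<^sub>v x) $ i / x $ i" by simp
      then show ?thesis using x0[OF that] by (simp add: pos_le_divide_eq)
    qed
    ultimately show False
      using spectral_radius_le_one_no_expansion[OF A n nonneg roots x x0] by blast
  qed
  \<comment> \<open>The equality for \<open>y\<close> carries over to \<open>x\<close>, because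
    \<open>A\<close> commutes with its powers.\<close>
  then have "A *\<^sub>v x = x"
    unfolding x_def by (metis pow_mat_mult_vec_commute[OF A y])
  then have "(\<Sum>j<n. A $$ (i, j) * x $ j) = x $ i" if "i < n" for i
    using mult_mat_vec_index_sum[OF A x that] by simp
  then show thesis using x0 that by blast
qed

text \<open>Conjugation by the diagonal matrix of the Perron vector \<open>x\<close> turns the
  \<open>i\<close>-th row sum into the \<open>i\<close>-th coordinate of \<open>A\<close> applied to
  \<open>x\<close>, divided by \<open>x i\<close>, which is 1.\<close>

lemma primitive_similar_stochastic:
  fixes A :: "real mat"
  assumes A: "A \<in> carrier_mat n n" and prim: "primitive_mat A"
    and root: "poly (char_poly A) 1 = 0"
    and roots: "\<And>z. poly (map_poly complex_of_real (char_poly A)) z = 0 \<Longrightarrow> cmod z \<le> 1"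
  obtains B where "stochastic n B" "char_poly B = char_poly A"
proof -
  have nonneg: "0 \<le> A $$ (i, j)" if "i < n" "j < n" for i j
    using prim A that by (simp add: primitive_mat_def)
  obtain k where pos: "\<And>i j. i < n \<Longrightarrow> j < n \<Longrightarrow> 0 < (A ^\<^sub>m k) $$ (i, j)"
    using prim carrier_matD(1)[OF A] unfolding primitive_mat_def by blast
  obtain x where x: "\<And>i. i < n \<Longrightarrow> 0 < x i" and ev: "\<And>i. i < n \<Longrightarrow> (\<Sum>j<n. A $$ (i, j) * x j) = x i"
    using primitive_perron_vector[OF A nonneg pos root roots] by blast
  define B where "B = mat n n (\<lambda>(i, j). 1 / x i * A $$ (i, j) * x j)"
  have diag: "mat_diag n f = 1\<^sub>m n" if "\<And>i. i < n \<Longrightarrow> f i = 1" for f :: "nat \<Rightarrow> real"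
    using that by (intro eq_matI) (auto simp: mat_diag_def)
  have "similar_mat B A"
  proof (rule similar_matI)
    show "{B, A, mat_diag n (\<lambda>i. 1 / x i), mat_diag n x} \<subseteq> carrier_mat n n"
      using A by (simp add: B_def)
    show "mat_diag n (\<lambda>i. 1 / x i) * mat_diag n x = 1\<^sub>m n"
      using x by (simp, intro diag) (auto simp: less_imp_neq[symmetric])
    show "mat_diag n x * mat_diag n (\<lambda>i. 1 / x i) = 1\<^sub>m n"
      using x by (simp, intro diag) (auto simp: less_imp_neq[symmetric])
    show "B = mat_diag n (\<lambda>i. 1 / x i) * A * mat_diag n x"
      unfolding mat_diag_mult_left[OF A] B_def
      by (subst mat_diag_mult_right[of _ n]) (auto intro!: eq_matI)
  qed
  moreover have "stochastic n B"
  proof -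
    have "(\<Sum>j<n. B $$ (i, j)) = 1" if i: "i < n" for i
    proof -
      have "(\<Sum>j<n. B $$ (i, j)) = 1 / x i * (\<Sum>j<n. A $$ (i, j) * x j)"
        using i by (simp add: B_def sum_distrib_left mult.assoc)
      then show ?thesis using ev[OF i] x[OF i] by simp
    qed
    then show ?thesis
      using nonneg x by (auto simp: stochastic_def B_def less_imp_le intro!: mult_nonneg_nonneg divide_nonneg_nonneg)
  qed
  ultimately show thesis using char_poly_similar that by blast
qed

section \<open>Compactness: passing to the limit of stochastic matrices\<close>

text \<open>By the Leibniz formula, the value at \<open>t\<close> is a polynomial in the entries of
  the matrix, hence continuous in them.\<close>

lemma tendsto_poly_char_poly:
  fixes B :: "nat \<Rightarrow> real mat"
  assumes B: "\<And>k. B k \<in> carrier_mat n n" and L: "L \<in> carrier_mat n n"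
    and lim: "\<And>i j. i < n \<Longrightarrow> j < n \<Longrightarrow> (\<lambda>k. B k $$ (i, j)) \<longlonglongrightarrow> L $$ (i, j)"
  shows "(\<lambda>k. poly (char_poly (B k)) t) \<longlonglongrightarrow> poly (char_poly L) t"
proof -
  have poly: "poly (char_poly A) t = (\<Sum>p | p permutes {0..<n}. signof p *
      (\<Prod>i = 0..<n. (if i = p i then t else 0) - A $$ (i, p i)))"
    if A: "A \<in> carrier_mat n n" for A :: "real mat"
  proof -
    have "- (char_matrix A t) \<in> carrier_mat n n" using A by simp
    then have "poly (char_poly A) t = (\<Sum>p | p permutes {0..<n}. signof p *
        (\<Prod>i = 0..<n. (- (char_matrix A t)) $$ (i, p i)))"
      unfolding char_poly_matrix[OF A] by (rule det_def')
    also have "\<dots> = (\<Sum>p | p permutes {0..<n}. signof p *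
      (\<Prod>i = 0..<n. (if i = p i then t else 0) - A $$ (i, p i)))"
    proof (intro sum.cong refl arg_cong2[where f = "(*)"] prod.cong)
      fix p i assume "p \<in> {p. p permutes {0..<n}}" "i \<in> {0..<n}"
      then have "i < n" "p i < n" using permutes_in_image[of p "{0..<n}" i] by auto
      then show "(- (char_matrix A t)) $$ (i, p i) = (if i = p i then t else 0) - A $$ (i, p i)"
        using A by (auto simp: char_matrix_def)
    qed
    finally show ?thesis .
  qed
  show ?thesis
    unfolding poly[OF B] poly[OF L]
  proof (intro tendsto_intros)
    fix p i assume "p \<in> {p. p permutes {0..<n}}" "i \<in> {0..<n}"
    then have "i < n" "p i < n" using permutes_in_image[of p "{0..<n}" i] by auto
    then show "(\<lambda>k. B k $$ (i, p i)) \<longlonglongrightarrow> L $$ (i, p i)" by (rule lim)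
  qed
qed

text \<open>Bolzano-Weierstrass in finitely many coordinates: each induction step passes to a
  further subsequence that is monotone in the new coordinate.\<close>

lemma simultaneous_convergent_subsequence:
  fixes f :: "'i \<Rightarrow> nat \<Rightarrow> real"
  assumes "finite I" "\<And>i k. i \<in> I \<Longrightarrow> \<bar>f i k\<bar> \<le> c"
  obtains r L where "strict_mono (r :: nat \<Rightarrow> nat)" "\<And>i. i \<in> I \<Longrightarrow> (\<lambda>k. f i (r k)) \<longlonglongrightarrow> L i"
proof -
  have "\<exists>r L. strict_mono (r :: nat \<Rightarrow> nat) \<and> (\<forall>i\<in>I. (\<lambda>k. f i (r k)) \<longlonglongrightarrow> L i)"
    using assms
  proof (induction I)
    case empty
    show ?case by (intro exI[of _ id]) (simp add: strict_mono_def)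
  next
    case (insert a I)
    from insert.IH insert.prems have
      "\<exists>r L. strict_mono (r :: nat \<Rightarrow> nat) \<and> (\<forall>i\<in>I. (\<lambda>k. f i (r k)) \<longlonglongrightarrow> L i)" by simp
    then obtain r L where r: "strict_mono (r :: nat \<Rightarrow> nat)"
      "\<And>i. i \<in> I \<Longrightarrow> (\<lambda>k. f i (r k)) \<longlonglongrightarrow> L i" by blast
    obtain q where q: "strict_mono q" "monoseq (\<lambda>k. f a (r (q k)))"
      using seq_monosub[of "\<lambda>k. f a (r k)"] by (auto simp: comp_def)
    have "Bseq (\<lambda>k. f a (r (q k)))"
      using insert.prems by (intro BseqI'[of _ c]) auto
    then obtain l where l: "(\<lambda>k. f a (r (q k))) \<longlonglongrightarrow> l"
      using Bseq_monoseq_convergent q(2) by (auto simp: convergent_def)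
    have "(\<lambda>k. f i (r (q k))) \<longlonglongrightarrow> (L(a := l)) i" if "i \<in> insert a I" for i
      using that l insert.hyps LIMSEQ_subseq_LIMSEQ[OF r(2) q(1), of i] by (auto simp: comp_def)
    moreover have "strict_mono (\<lambda>k. r (q k))"
      using strict_mono_compose[OF r(1) q(1)] by (simp add: comp_def)
    ultimately show ?case by blast
  qed
  then show thesis using that by blast
qed

text \<open>Dividing by the oscillation keeps a limit of such vectors from being constant. The
  quotient stays bounded because \<open>s < 1\<close> forces the maximum of an eigenvector to be
  nonnegative and its minimum nonpositive. The double sum expresses nonconstancy without naming
  extremal indices, so it passes to limits directly.\<close>

lemma stochastic_normalized_eigenvector:
  assumes B: "stochastic n B" and root: "poly (char_poly B) s = 0" and s: "s < 1"
  obtains v where "\<And>i. i < n \<Longrightarrow> (\<Sum>j<n. B $$ (i, j) * v j) = s * v i"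
    "\<And>i. i < n \<Longrightarrow> \<bar>v i\<bar> \<le> 1" "1 \<le> (\<Sum>i<n. \<Sum>j<n. \<bar>v i - v j\<bar>)"
proof -
  have Bc: "B \<in> carrier_mat n n" using B by (simp add: stochastic_def)
  obtain w where w: "w \<in> carrier_vec n" "w \<noteq> 0\<^sub>v n" "B *\<^sub>v w = s \<cdot>\<^sub>v w"
    using root_char_polyE[OF Bc root] by blast
  have ev: "(\<Sum>j<n. B $$ (i, j) * w $ j) = s * w $ i" if "i < n" for i
    using mult_mat_vec_index_sum[OF Bc w(1) that] w that by simp
  obtain d where d: "d < n" "w $ d \<noteq> 0"
    using w(1,2) by (metis carrier_vecD eq_vecI index_zero_vec)
  \<comment> \<open>Used for the eigenvector and for its negative. At a maximal index averaging
    gives \<open>s * u a \<le> u a\<close>.\<close>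
  have nonneg_max: "0 \<le> u a"
    if evu: "\<And>i. i < n \<Longrightarrow> (\<Sum>j<n. B $$ (i, j) * u j) = s * u i"
      and a: "a < n" "\<And>j. j < n \<Longrightarrow> u j \<le> u a" for u :: "nat \<Rightarrow> real" and a
  proof -
    have "s * u a = (\<Sum>j<n. B $$ (a, j) * u j)" using evu[OF a(1)] by simp
    also have "\<dots> \<le> (\<Sum>j<n. B $$ (a, j) * u a)"
      using B a by (intro sum_mono mult_left_mono) (auto simp: stochastic_def)
    also have "\<dots> = u a" using B a by (simp add: stochastic_def sum_distrib_right[symmetric])
    finally have "0 \<le> (1 - s) * u a" by (simp add: algebra_simps)
    then show ?thesis using s by (simp add: zero_le_mult_iff)
  qed
  have ne: "finite ((\<lambda>i. w $ i) ` {..<n})" "(\<lambda>i. w $ i) ` {..<n} \<noteq> {}" using d by auto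
  obtain a where a: "a < n" "\<And>j. j < n \<Longrightarrow> w $ j \<le> w $ a"
  proof -
    obtain a where "a < n" "Max ((\<lambda>i. w $ i) ` {..<n}) = w $ a" using Max_in[OF ne] by auto
    then show thesis using that[of a] Max_ge[OF ne(1)] by fastforce
  qed
  obtain b where b: "b < n" "\<And>j. j < n \<Longrightarrow> w $ b \<le> w $ j"
  proof -
    obtain b where "b < n" "Min ((\<lambda>i. w $ i) ` {..<n}) = w $ b" using Min_in[OF ne] by auto
    then show thesis using that[of b] Min_le[OF ne(1)] by fastforce
  qed
  have a0: "0 \<le> w $ a" using nonneg_max[OF ev a] .
  have b0: "w $ b \<le> 0"
    using nonneg_max[of "\<lambda>j. - (w $ j)" b] ev b by (simp add: sum_negf)
  define h where "h = w $ a - w $ b"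
  have h: "0 < h"
    using a0 b0 a(2)[OF d(1)] b(2)[OF d(1)] d(2) by (auto simp: h_def)
  define v where "v i = w $ i / h" for i
  have "(\<Sum>j<n. B $$ (i, j) * v j) = s * v i" if "i < n" for i
    using ev[OF that] by (simp add: v_def sum_divide_distrib[symmetric])
  moreover have "\<bar>v i\<bar> \<le> 1" if "i < n" for i
  proof -
    have "\<bar>w $ i\<bar> \<le> h" using a(2)[OF that] b(2)[OF that] a0 b0 by (simp add: h_def)
    then show ?thesis using h by (simp add: v_def)
  qed
  moreover have "1 \<le> (\<Sum>i<n. \<Sum>j<n. \<bar>v i - v j\<bar>)"
  proof -
    have "1 = v a - v b" using h by (simp add: v_def diff_divide_distrib[symmetric] h_def[symmetric])
    also have "\<dots> \<le> \<bar>v a - v b\<bar>" by simp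
    also have "\<dots> \<le> (\<Sum>j<n. \<bar>v a - v j\<bar>)"
      using b(1) by (intro member_le_sum) auto
    also have "\<dots> \<le> (\<Sum>i<n. \<Sum>j<n. \<bar>v i - v j\<bar>)"
      using a(1) by (intro member_le_sum[where f = "\<lambda>i. \<Sum>j<n. \<bar>v i - v j\<bar>"]) (auto intro: sum_nonneg)
    finally show ?thesis .
  qed
  ultimately show thesis using that by blast
qed

text \<open>The size \<open>n\<close> is fixed and the entries lie between 0 and 1, so a subsequence
  converges. The limit is stochastic, has 1 as a double root, and fixes the limit of the normalized
  eigenvectors for \<open>s k\<close>; \<open>stochastic_char_poly_neq\<close> excludes
  this.\<close>

lemma no_stochastic_sequence:
  fixes s :: "nat \<Rightarrow> real"
  assumes B: "\<And>k. stochastic n (B k)"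
    and cp: "\<And>k. char_poly (B k) = monom 1 m * ([:-1, 1:] * ([:- s k, 1:] * quad))"
    and s: "\<And>k. s k < 1" "s \<longlonglongrightarrow> 1"
  shows False
proof -
  have Bc: "B k \<in> carrier_mat n n" for k using B by (simp add: stochastic_def)
  have "\<exists>v. (\<forall>i<n. (\<Sum>j<n. B k $$ (i, j) * v j) = s k * v i) \<and>
      (\<forall>i<n. \<bar>v i\<bar> \<le> 1) \<and> 1 \<le> (\<Sum>i<n. \<Sum>j<n. \<bar>v i - v j\<bar>)" for k
  proof -
    have "poly (char_poly (B k)) (s k) = 0" by (simp add: cp)
    from stochastic_normalized_eigenvector[OF B this s(1)] obtain v where
      "\<And>i. i < n \<Longrightarrow> (\<Sum>j<n. B k $$ (i, j) * v j) = s k * v i"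
      "\<And>i. i < n \<Longrightarrow> \<bar>v i\<bar> \<le> 1" "1 \<le> (\<Sum>i<n. \<Sum>j<n. \<bar>v i - v j\<bar>)" by blast
    then show ?thesis by blast
  qed
  then have "\<exists>v. \<forall>k. (\<forall>i<n. (\<Sum>j<n. B k $$ (i, j) * v k j) = s k * v k i) \<and>
      (\<forall>i<n. \<bar>v k i\<bar> \<le> 1) \<and> 1 \<le> (\<Sum>i<n. \<Sum>j<n. \<bar>v k i - v k j\<bar>)"
    by (intro choice allI)
  then obtain v where
    ev: "\<And>k i. i < n \<Longrightarrow> (\<Sum>j<n. B k $$ (i, j) * v k j) = s k * v k i" and
    bd: "\<And>k i. i < n \<Longrightarrow> \<bar>v k i\<bar> \<le> 1" and
    spread: "\<And>k. 1 \<le> (\<Sum>i<n. \<Sum>j<n. \<bar>v k i - v k j\<bar>)" by blast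
  have entry: "\<bar>B k $$ (i, j)\<bar> \<le> 1" if "i < n" "j < n" for k i j
  proof -
    have "B k $$ (i, j) \<le> (\<Sum>j<n. B k $$ (i, j))"
      using B[of k] that by (intro member_le_sum) (auto simp: stochastic_def)
    then show ?thesis using B[of k] that by (simp add: stochastic_def)
  qed
  \<comment> \<open>Two successive extractions: \<open>r\<close> makes the matrices converge, and
    \<open>q\<close> then makes the eigenvectors converge as well.\<close>
  obtain r L where r: "strict_mono (r :: nat \<Rightarrow> nat)" and
    L: "\<And>ij. ij \<in> {..<n} \<times> {..<n} \<Longrightarrow> (\<lambda>k. B (r k) $$ ij) \<longlonglongrightarrow> L ij"
    by (rule simultaneous_convergent_subsequence[of "{..<n} \<times> {..<n}" "\<lambda>ij k. B k $$ ij" 1])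
      (use entry in auto)
  obtain q u where q: "strict_mono (q :: nat \<Rightarrow> nat)" and
    u: "\<And>i. i \<in> {..<n} \<Longrightarrow> (\<lambda>k. v (r (q k)) i) \<longlonglongrightarrow> u i"
    by (rule simultaneous_convergent_subsequence[of "{..<n}" "\<lambda>i k. v (r k) i" 1]) (use bd in auto)
  have rq: "strict_mono (\<lambda>k. r (q k))" using strict_mono_compose[OF r q] by (simp add: comp_def)
  define M where "M = mat n n L"
  have Mc: "M \<in> carrier_mat n n" by (simp add: M_def)
  have limM: "(\<lambda>k. B (r (q k)) $$ (i, j)) \<longlonglongrightarrow> M $$ (i, j)" if "i < n" "j < n" for i j
    using LIMSEQ_subseq_LIMSEQ[OF L q, of "(i, j)"] that by (simp add: M_def comp_def)
  have lims: "(\<lambda>k. s (r (q k))) \<longlonglongrightarrow> 1"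
    using LIMSEQ_subseq_LIMSEQ[OF s(2) rq] by (simp add: comp_def)
  have "stochastic n M"
    unfolding stochastic_def
  proof (intro conjI allI impI Mc)
    fix i j assume ij: "i < n" "j < n"
    show "0 \<le> M $$ (i, j)"
      using B ij by (intro tendsto_lowerbound[OF limM[OF ij]] always_eventually) (auto simp: stochastic_def)
  next
    fix i assume i: "i < n"
    have "(\<lambda>k. \<Sum>j<n. B (r (q k)) $$ (i, j)) \<longlonglongrightarrow> (\<Sum>j<n. M $$ (i, j))"
      using i by (intro tendsto_sum limM) auto
    moreover have "(\<lambda>k. \<Sum>j<n. B (r (q k)) $$ (i, j)) = (\<lambda>k. 1)"
      using B i by (simp add: stochastic_def)
    ultimately show "(\<Sum>j<n. M $$ (i, j)) = 1" by (simp add: LIMSEQ_const_iff)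
  qed
  moreover have "(\<Sum>j<n. M $$ (i, j) * u j) = u i" if i: "i < n" for i
  proof -
    have "(\<lambda>k. \<Sum>j<n. B (r (q k)) $$ (i, j) * v (r (q k)) j) \<longlonglongrightarrow> (\<Sum>j<n. M $$ (i, j) * u j)"
      using i by (intro tendsto_sum tendsto_mult limM u) auto
    moreover have "(\<lambda>k. s (r (q k)) * v (r (q k)) i) \<longlonglongrightarrow> 1 * u i"
      using i by (intro tendsto_mult lims u) auto
    ultimately show ?thesis using LIMSEQ_unique i by (simp add: ev)
  qed
  moreover have "\<exists>a b. a < n \<and> b < n \<and> u a \<noteq> u b"
  proof (rule ccontr)
    assume "\<nexists>a b. a < n \<and> b < n \<and> u a \<noteq> u b"
    then have eq: "u i = u j" if "i < n" "j < n" for i j using that by blast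
    have "(\<Sum>i<n. \<Sum>j<n. \<bar>u i - u j\<bar>) = 0"
    proof (intro sum.neutral ballI)
      fix i j assume "i \<in> {..<n}" "j \<in> {..<n}"
      then have "u i = u j" by (intro eq) simp_all
      then show "\<bar>u i - u j\<bar> = 0" by simp
    qed
    moreover have "(\<lambda>k. \<Sum>i<n. \<Sum>j<n. \<bar>v (r (q k)) i - v (r (q k)) j\<bar>)
        \<longlonglongrightarrow> (\<Sum>i<n. \<Sum>j<n. \<bar>u i - u j\<bar>)"
      by (intro tendsto_intros u) auto
    then have "1 \<le> (\<Sum>i<n. \<Sum>j<n. \<bar>u i - u j\<bar>)"
      by (rule tendsto_lowerbound) (use spread in auto)
    ultimately show False by simp
  qed
  moreover have "char_poly M = monom 1 m * ([:-1, 1:] * ([:-1, 1:] * quad))"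
  proof (rule poly_ext)
    fix t
    have poly: "poly (monom 1 m * ([:-1, 1:] * ([:- a, 1:] * quad))) t
        = t ^ m * ((t - 1) * ((t - a) * poly quad t))" for a
      unfolding poly_mult poly_monom by simp
    have "(\<lambda>k. t ^ m * ((t - 1) * ((t - s (r (q k))) * poly quad t)))
        \<longlonglongrightarrow> t ^ m * ((t - 1) * ((t - 1) * poly quad t))"
      by (intro tendsto_intros lims)
    then have "(\<lambda>k. poly (char_poly (B (r (q k)))) t)
        \<longlonglongrightarrow> poly (monom 1 m * ([:-1, 1:] * ([:-1, 1:] * quad))) t"
      by (simp only: cp poly)
    moreover have "(\<lambda>k. poly (char_poly (B (r (q k)))) t) \<longlonglongrightarrow> poly (char_poly M) t"
      by (rule tendsto_poly_char_poly[OF Bc Mc limM])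
    ultimately show "poly (char_poly M) t = poly (monom 1 m * ([:-1, 1:] * ([:-1, 1:] * quad))) t"
      by (intro LIMSEQ_unique)
  qed
  ultimately show False using stochastic_char_poly_neq by blast
qed

text \<open>The degree forces the exponent to be \<open>n - 4\<close>.\<close>

lemma eventually_no_stochastic:
  "\<forall>\<^sub>F s in at_left (1 :: real). \<nexists>B. stochastic n B \<and>
     char_poly B = monom 1 (n - 4) * ([:-1, 1:] * ([:- s, 1:] * quad))"
proof (rule ccontr)
  let ?P = "\<lambda>s. \<exists>B. stochastic n B \<and> char_poly B = monom 1 (n - 4) * ([:-1, 1:] * ([:- s, 1:] * quad))"
  assume "\<not> ?thesis"
  then have freq: "\<exists>\<^sub>F s in at_left (1 :: real). ?P s" by (simp add: frequently_def)
  \<comment> \<open>If the claim fails, realizable values of \<open>s\<close> occur arbitrarily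
    close to 1 from the left; one is chosen for each \<open>k\<close>.\<close>
  have "\<exists>s. 1 - 1 / real (Suc k) < s \<and> s < 1 \<and> ?P s" for k
  proof -
    have "\<forall>\<^sub>F s in at_left 1. s \<in> {1 - 1 / real (Suc k)<..<1}"
      by (rule eventually_at_left_real) simp
    from frequently_ex[OF frequently_eventually_frequently[OF freq this]] show ?thesis by auto
  qed
  then obtain s B where s: "\<And>k. 1 - 1 / real (Suc k) < s k" "\<And>k. s k < 1"
    and B: "\<And>k. stochastic n (B k)"
      "\<And>k. char_poly (B k) = monom 1 (n - 4) * ([:-1, 1:] * ([:- s k, 1:] * quad))"
    by metis
  have "s \<longlonglongrightarrow> 1"
  proof (rule tendsto_sandwich)
    show "(\<lambda>k. 1 - 1 / real (Suc k)) \<longlonglongrightarrow> 1" by real_asymp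
    show "(\<lambda>k. 1) \<longlonglongrightarrow> (1 :: real)" by simp
  qed (use s in \<open>auto intro!: always_eventually less_imp_le\<close>)
  then show False by (rule no_stochastic_sequence[OF B s(2)])
qed

section \<open>The family of spectra and its tracial floor\<close>

lemma poly_root_poly_eq_0_iff: "poly (root_poly \<Lambda>) z = 0 \<longleftrightarrow> z \<in> set \<Lambda>"
  by (induction \<Lambda>) (auto simp: root_poly_def simp del: mult_pCons_left mult_pCons_right)

definition zeta :: complex where "zeta = Complex (-3/5) (1/5)"

definition family :: "real \<Rightarrow> complex list" where
  "family s = [1, complex_of_real s, zeta, cnj zeta]"

lemma root_poly_family:
  "root_poly (family s) = map_poly complex_of_real ([:-1, 1:] * ([:- s, 1:] * quad))"
  by (simp add: root_poly_def family_def quad_def zeta_def map_poly_pCons algebra_simps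
      complex_eq_iff power2_eq_square)

lemma cmod_zeta: "(cmod zeta)\<^sup>2 = 2/5"
  by (simp add: zeta_def cmod_power2 power_divide)

lemma cmod_zeta_bounds: "0 < cmod zeta" "cmod zeta \<le> 9/10"
proof -
  show "0 < cmod zeta" using cmod_zeta by (cases "zeta = 0") auto
  show "cmod zeta \<le> 9/10" by (rule power2_le_imp_le) (simp_all add: cmod_zeta power_divide)
qed

lemma Re_power_trace_family: "Re (power_trace (family s) k) = 1 + s ^ k + 2 * Re (zeta ^ k)"
  by (simp add: power_trace_def family_def flip: complex_cnj_power of_real_power)

text \<open>The threshold 9/10 works because 2 |zeta|^2 = 4/5 is at most 81/100, and each further
  power multiplies the left side by |zeta|, which is at most 9/10. So the conjugate pair never
  outweighs \<open>s ^ k\<close>.\<close>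

lemma one_le_power_trace_family:
  assumes s: "9/10 \<le> s" and k: "2 \<le> k"
  shows "1 \<le> Re (power_trace (family s) k)"
proof -
  obtain l where l: "k = 2 + l" using k by (metis le_add_diff_inverse)
  have "2 * cmod zeta ^ k = 2 * (cmod zeta)\<^sup>2 * cmod zeta ^ l" by (simp only: l power_add mult.assoc)
  also have "\<dots> \<le> (9/10)\<^sup>2 * (9/10) ^ l"
    unfolding cmod_zeta using cmod_zeta_bounds
    by (intro mult_mono power_mono) (auto simp: power_divide)
  also have "\<dots> = (9/10) ^ k" by (simp only: l power_add)
  also have "\<dots> \<le> s ^ k" using s by (intro power_mono) auto
  finally have "2 * cmod zeta ^ k \<le> s ^ k" .
  moreover have "\<bar>Re (zeta ^ k)\<bar> \<le> cmod zeta ^ k"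
    using abs_Re_le_cmod[of "zeta ^ k"] by (simp add: norm_power)
  ultimately show ?thesis unfolding Re_power_trace_family by linarith
qed

lemma admissible_family:
  assumes s: "9/10 \<le> s" "s < 1"
  shows "admissible (family s)"
  unfolding admissible_def
proof (intro conjI allI impI)
  show "2 \<le> length (family s)" by (simp add: family_def)
  show "0 \<notin> set (family s)" using s cmod_zeta_bounds by (auto simp: family_def)
  show "family s ! 0 = 1" by (simp add: family_def)
  show "cmod (family s ! i) < 1" if "1 \<le> i \<and> i < length (family s)" for i
  proof -
    from that have "i = 1 \<or> i = 2 \<or> i = 3" by (auto simp: family_def)
    then show ?thesis using s cmod_zeta_bounds by (auto simp: family_def numeral_3_eq_3 numeral_2_eq_2)
  qed
  show "coeff (root_poly (family s)) i \<in> \<real>" for i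
    by (simp add: root_poly_family coeff_map_poly)
  \<comment> \<open>The first trace is \<open>s - 1/5\<close>; the estimate for
    \<open>k \<ge> 2\<close> does not cover it.\<close>
  show "0 \<le> Re (power_trace (family s) 1)"
    using s by (simp add: Re_power_trace_family zeta_def)
  show "0 < Re (power_trace (family s) k)" if "2 \<le> k" for k
    using one_le_power_trace_family[OF s(1) that] by simp
qed

text \<open>All traces from \<open>k = 2\<close> on are at least 1, and they tend to 1 because the
  other eigenvalues have modulus below 1. The floor is thus the same for every
  \<open>s\<close>.\<close>

lemma tracial_floor_family:
  assumes s: "9/10 \<le> s" "s < 1"
  shows "tracial_floor (family s) = 1"
  unfolding tracial_floor_def
proof (rule antisym)
  let ?g = "\<lambda>k. Re (power_trace (family s) k)"
  show "1 \<le> (INF k\<in>{2..}. ?g k)"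
    using one_le_power_trace_family[OF s(1)] by (intro cINF_greatest) auto
  have "bdd_below (?g ` {2..})"
    using one_le_power_trace_family[OF s(1)] by (intro bdd_belowI[of _ 1]) auto
  then have le: "(INF k\<in>{2..}. ?g k) \<le> ?g k" if "2 \<le> k" for k
    using that by (intro cINF_lower) auto
  have "(\<lambda>k. zeta ^ k) \<longlonglongrightarrow> 0" using cmod_zeta_bounds by (intro LIMSEQ_power_zero) simp
  then have "(\<lambda>k. Re (zeta ^ k)) \<longlonglongrightarrow> 0" using tendsto_Re by fastforce
  moreover have "(\<lambda>k. s ^ k) \<longlonglongrightarrow> 0" using s by (intro LIMSEQ_power_zero) simp
  ultimately have "(\<lambda>k. 1 + s ^ k + 2 * Re (zeta ^ k)) \<longlonglongrightarrow> 1 + 0 + 2 * 0"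
    by (intro tendsto_add tendsto_mult tendsto_const)
  then have "?g \<longlonglongrightarrow> 1" by (simp add: Re_power_trace_family)
  then show "(INF k\<in>{2..}. ?g k) \<le> 1"
    by (rule tendsto_lowerbound) (use le in \<open>auto simp: eventually_sequentially\<close>)
qed

section \<open>From realizations of the family to the contradiction\<close>

lemma family_realization_stochastic:
  assumes A: "A \<in> carrier_mat n n" and prim: "primitive_mat A"
    and spec: "has_nonzero_spectrum A (family s)" and s: "9/10 \<le> s" "s < 1"
  obtains B where "stochastic n B"
    "char_poly B = monom 1 (n - 4) * ([:-1, 1:] * ([:- s, 1:] * quad))"
proof -
  obtain j where j: "map_poly complex_of_real (char_poly A) = monom 1 j * root_poly (family s)"
    using spec by (auto simp: has_nonzero_spectrum_def)
  let ?q = "[:-1, 1:] * ([:- s, 1:] * quad)"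
  have ev: "complex_of_real (poly p x) = poly (map_poly complex_of_real p) (complex_of_real x)" for p x
    by (simp add: of_real_hom.poly_map_poly)
  \<comment> \<open>The spectrum is given over the complex numbers; comparing values at real points
    brings the identity down to real polynomials.\<close>
  have cp: "char_poly A = monom 1 j * ?q"
  proof (rule poly_ext)
    fix x
    have "complex_of_real (poly (char_poly A) x) = complex_of_real (x ^ j * poly ?q x)"
      unfolding of_real_mult of_real_power ev j root_poly_family
      by (simp only: poly_mult[of "monom 1 j"] poly_monom mult_1)
    then show "poly (char_poly A) x = poly (monom 1 j * ?q) x"
      by (simp only: of_real_eq_iff poly_mult poly_monom mult_1)
  qed
  have "degree ?q = 4" by (simp add: quad_def)
  then have "degree (monom 1 j * ?q) = j + 4"
    by (subst degree_mult_eq) (auto simp: degree_monom_eq)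
  then have "degree (char_poly A) = j + 4" by (simp only: cp)
  then have n: "j = n - 4" using degree_monic_char_poly[OF A] by linarith
  have "poly (char_poly A) 1 = 0" by (simp add: cp)
  moreover have "cmod z \<le> 1" if "poly (map_poly complex_of_real (char_poly A)) z = 0" for z
  proof -
    have "z = 0 \<or> z \<in> set (family s)"
      using that unfolding j poly_mult poly_monom by (auto simp: poly_root_poly_eq_0_iff)
    then show ?thesis using s cmod_zeta_bounds by (auto simp: family_def)
  qed
  ultimately obtain B where "stochastic n B" "char_poly B = char_poly A"
    using primitive_similar_stochastic[OF A prim] by metis
  then show thesis using that cp n by simp
qed

text \<open>Since the floor is always 1, the single number \<open>f 1\<close> would bound the sizes
  for the whole family.\<close>

lemma no_bound_in_tracial_floor: "\<nexists>f :: real \<Rightarrow> nat. \<forall>\<Lambda>. admissible \<Lambda> \<and> length \<Lambda> = 4 \<longrightarrow>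
            (\<exists>N \<le> f (tracial_floor \<Lambda>). \<exists>A \<in> carrier_mat N N.
               primitive_mat A \<and> has_nonzero_spectrum A \<Lambda>)"
proof
  assume "\<exists>f :: real \<Rightarrow> nat. \<forall>\<Lambda>. admissible \<Lambda> \<and> length \<Lambda> = 4 \<longrightarrow>
            (\<exists>N \<le> f (tracial_floor \<Lambda>). \<exists>A \<in> carrier_mat N N.
               primitive_mat A \<and> has_nonzero_spectrum A \<Lambda>)"
  then obtain f :: "real \<Rightarrow> nat" where f: "\<And>\<Lambda>. admissible \<Lambda> \<Longrightarrow> length \<Lambda> = 4 \<Longrightarrow>
      \<exists>N \<le> f (tracial_floor \<Lambda>). \<exists>A \<in> carrier_mat N N. primitive_mat A \<and> has_nonzero_spectrum A \<Lambda>"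
    by blast
  \<comment> \<open>The size may vary with \<open>s\<close>, but only finitely many sizes are
    allowed. Each is excluded for \<open>s\<close> close to 1, hence all of them are excluded at
    once.\<close>
  have "\<forall>\<^sub>F s in at_left (1 :: real). \<forall>N\<in>{..f 1}. \<nexists>B. stochastic N B \<and>
     char_poly B = monom 1 (N - 4) * ([:-1, 1:] * ([:- s, 1:] * quad))"
    by (intro eventually_ball_finite eventually_no_stochastic ballI) auto
  moreover have "\<forall>\<^sub>F s in at_left (1 :: real). s \<in> {9/10<..<1}"
    by (rule eventually_at_left_real) simp
  ultimately have "\<forall>\<^sub>F s in at_left (1 :: real). False"
  proof eventually_elim
    case (elim s)
    then have s: "9/10 \<le> s" "s < 1" by auto
    obtain N A where "N \<le> f 1" "A \<in> carrier_mat N N" "primitive_mat A" "has_nonzero_spectrum A (family s)"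
      using f[OF admissible_family[OF s]] tracial_floor_family[OF s] by (auto simp: family_def)
    then show ?case using family_realization_stochastic[OF _ _ _ s] elim(1) by (metis atMost_iff)
  qed
  then show False by simp
qed

theorem proposition4p12p13:
  shows "(\<nexists>f :: real \<Rightarrow> nat \<Rightarrow> nat. \<forall>\<Lambda>. admissible \<Lambda> \<longrightarrow>
            (\<exists>N \<le> f (tracial_floor \<Lambda>) (length \<Lambda>). \<exists>A \<in> carrier_mat N N.
               primitive_mat A \<and> has_nonzero_spectrum A \<Lambda>)) \<and>
         (\<nexists>f :: real \<Rightarrow> nat. \<forall>\<Lambda>. admissible \<Lambda> \<and> length \<Lambda> = 4 \<longrightarrow>
            (\<exists>N \<le> f (tracial_floor \<Lambda>). \<exists>A \<in> carrier_mat N N.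
               primitive_mat A \<and> has_nonzero_spectrum A \<Lambda>))"
proof (rule conjI[OF notI no_bound_in_tracial_floor])
  assume "\<exists>f :: real \<Rightarrow> nat \<Rightarrow> nat. \<forall>\<Lambda>. admissible \<Lambda> \<longrightarrow>
            (\<exists>N \<le> f (tracial_floor \<Lambda>) (length \<Lambda>). \<exists>A \<in> carrier_mat N N.
               primitive_mat A \<and> has_nonzero_spectrum A \<Lambda>)"
  then obtain f :: "real \<Rightarrow> nat \<Rightarrow> nat" where f: "\<And>\<Lambda>. admissible \<Lambda> \<Longrightarrow>
      \<exists>N \<le> f (tracial_floor \<Lambda>) (length \<Lambda>). \<exists>A \<in> carrier_mat N N.
        primitive_mat A \<and> has_nonzero_spectrum A \<Lambda>"
    by blast
  show False
    \<comment> \<open>Fixing the length at 4 turns a bound in both quantities into one in the floor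
      alone.\<close>
    by (rule notE[OF no_bound_in_tracial_floor], rule exI[of _ "\<lambda>x. f x 4"]) (metis f)
qed

end
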